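(* Let $D$ be the generator of a strongly continuous one-parameter group of isometries $e^{tD}$, $t\in\mathbb{R}$, in a complex Banach space $E$. If $f\in\mathbf{B}_\sigma(D)$, then for every $g^*\in E^*$, every $0<\gamma<1$, and every $z\in\mathbb{C}$ one has: (1) the function $t\mapsto\langle e^{tD}f,g^*\rangle$ of the real variable $t$ belongs to $B^\infty_\sigma(\mathbb{R})$, which means that it has an extension $\langle e^{zD}f,g^*\rangle$ to the complex plane $\mathbb{C}$ as an entire function of exponential type $\sigma$; (2) the following sampling formula holds: $$\langle e^{zD}f,g^*\rangle=\sum_{k\in\mathbb{Z}}\big\langle e^{(\gamma k)D}f,g^*\big\rangle\,\mathrm{sinc}\big(\gamma^{-1}z-k\big),\qquad z\in\mathbb{C},$$ where the series converges uniformly on compact subsets of $\mathbb{C}$.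
   Context: $\mathcal{D}^\infty$ is the intersection of the domains of all powers $D^k$, $k\in\mathbb{N}$. For $\sigma\ge0$, $\mathbf{B}_\sigma(D)$ is the set of all $f\in\mathcal{D}^\infty$ such that $\|D^kf\|\le\sigma^k\|f\|$ for all $k\in\mathbb{N}=\{1,2,\dots\}$. For $f\in\mathbf{B}_\sigma(D)$ and $z\in\mathbb{C}$, $e^{zD}f=\sum_{k\ge0}z^kD^kf/k!$. $E^*$ is the dual space of $E$ and $\langle\cdot,\cdot\rangle$ is the duality pairing. $B^\infty_\sigma(\mathbb{R})$ is the space of bounded smooth functions on $\mathbb{R}$ whose distributional Fourier transform has support in $[-\sigma,\sigma]$; equivalently, restrictions to $\mathbb{R}$ of entire functions of exponential type (at most) $\sigma$ that are bounded on $\mathbb{R}$. $\mathrm{sinc}(z)=\frac{\sin\pi z}{\pi z}$ for $z\ne0$, $\mathrm{sinc}(0)=1$.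
   Formalization: The sampling formula (2) is stated and proved under the extra condition γσ < π; without it the formula is false (E = ℂ, D = ia with a = σ = 2π/γ, f = 1, z = γ/2). Part (1) holds for every σ ≥ 0 as stated. *)

theory Defs
  imports "HOL-Complex_Analysis.Complex_Analysis"
begin

section \<open>Complex Banach spaces\<close>

class complex_banach = banach +
  fixes scaleC :: "complex \<Rightarrow> 'a \<Rightarrow> 'a"  (infixr \<open>*\<^sub>C\<close> 75)
  assumes scaleC_add_right: "a *\<^sub>C (x + y) = a *\<^sub>C x + a *\<^sub>C y"
    and scaleC_add_left: "(a + b) *\<^sub>C x = a *\<^sub>C x + b *\<^sub>C x"
    and scaleC_scaleC: "a *\<^sub>C b *\<^sub>C x = (a * b) *\<^sub>C x"
    and scaleR_scaleC: "r *\<^sub>R x = complex_of_real r *\<^sub>C x"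
    and norm_scaleC: "norm (a *\<^sub>C x) = norm a * norm x"

instantiation complex :: complex_banach
begin

definition scaleC_complex :: "complex \<Rightarrow> complex \<Rightarrow> complex" where
  "scaleC_complex a z = a * z"

instance
  by standard
    (simp_all add: scaleC_complex_def algebra_simps norm_mult scaleR_conv_of_real)

end

definition bounded_clinear :: "('a::complex_banach \<Rightarrow> 'b::complex_banach) \<Rightarrow> bool" where
  "bounded_clinear T \<longleftrightarrow> bounded_linear T \<and> (\<forall>c x. T (c *\<^sub>C x) = c *\<^sub>C T x)"

section \<open>Isometry groups and their generators\<close>

definition isometry_group :: "(real \<Rightarrow> 'a::complex_banach \<Rightarrow> 'a) \<Rightarrow> bool" where
  "isometry_group U \<longleftrightarrow>
     (\<forall>t. bounded_clinear (U t)) \<and> (\<forall>t x. norm (U t x) = norm x) \<and>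
     (\<forall>x. U 0 x = x) \<and> (\<forall>s t x. U (s + t) x = U s (U t x)) \<and>
     (\<forall>x. continuous_on UNIV (\<lambda>t. U t x))"

text \<open>
  An unbounded operator is a pair of a domain \<open>A\<close> and a total function \<open>D\<close>. The values
  of \<open>D\<close> outside \<open>A\<close> are irrelevant.
\<close>

definition is_generator ::
  "(real \<Rightarrow> 'a::complex_banach \<Rightarrow> 'a) \<Rightarrow> 'a set \<Rightarrow> ('a \<Rightarrow> 'a) \<Rightarrow> bool" where
  "is_generator U A D \<longleftrightarrow>
     A = {x. \<exists>y. ((\<lambda>h. (U h x - x) /\<^sub>R h) \<longlongrightarrow> y) (at 0)} \<and>
     (\<forall>x\<in>A. ((\<lambda>h. (U h x - x) /\<^sub>R h) \<longlongrightarrow> D x) (at 0))"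

primrec pow_domain :: "'a set \<Rightarrow> ('a \<Rightarrow> 'a) \<Rightarrow> nat \<Rightarrow> 'a set" where
  "pow_domain A D 0 = UNIV"
| "pow_domain A D (Suc k) = {x \<in> A. D x \<in> pow_domain A D k}"

definition smooth_vectors :: "'a set \<Rightarrow> ('a \<Rightarrow> 'a) \<Rightarrow> 'a set" where
  "smooth_vectors A D = (\<Inter>k. pow_domain A D k)"

definition bernstein_vectors :: "real \<Rightarrow> 'a::complex_banach set \<Rightarrow> ('a \<Rightarrow> 'a) \<Rightarrow> 'a set" where
  "bernstein_vectors \<sigma> A D =
     {f \<in> smooth_vectors A D. \<forall>k\<ge>1. norm ((D ^^ k) f) \<le> \<sigma> ^ k * norm f}"

definition exp_op :: "complex \<Rightarrow> ('a::complex_banach \<Rightarrow> 'a) \<Rightarrow> 'a \<Rightarrow> 'a" where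
  "exp_op z D f = (\<Sum>k. (z ^ k / fact k) *\<^sub>C (D ^^ k) f)"

lemma exp_op_summable:
  assumes "f \<in> bernstein_vectors \<sigma> A D"
  shows "summable (\<lambda>k. norm ((z ^ k / fact k) *\<^sub>C (D ^^ k) f))"
proof (rule summable_comparison_test)
  have "norm (norm ((z ^ k / fact k) *\<^sub>C (D ^^ k) f))
          \<le> norm f * ((norm z * \<sigma>) ^ k /\<^sub>R fact k)" for k
  proof -
    have "norm ((D ^^ k) f) \<le> \<sigma> ^ k * norm f"
      using assms by (cases k) (auto simp: bernstein_vectors_def)
    then have "norm (z ^ k / fact k) * norm ((D ^^ k) f)
                 \<le> norm (z ^ k / fact k) * (\<sigma> ^ k * norm f)"
      by (intro mult_left_mono) auto
    then show ?thesis
      by (simp add: norm_scaleC norm_mult norm_inverse norm_power power_mult_distrib divide_inverse mult_ac)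
  qed
  then show "\<exists>N. \<forall>k\<ge>N. norm (norm ((z ^ k / fact k) *\<^sub>C (D ^^ k) f))
               \<le> norm f * ((norm z * \<sigma>) ^ k /\<^sub>R fact k)"
    by blast
  show "summable (\<lambda>k. norm f * ((norm z * \<sigma>) ^ k /\<^sub>R fact k))"
    by (intro summable_mult summable_exp_generic)
qed

section \<open>Entire functions of exponential type\<close>

text \<open>Exponential type is meant in the sense of ``type at most \<open>\<sigma>\<close>'' throughout.\<close>

definition entire_exp_type :: "real \<Rightarrow> (complex \<Rightarrow> complex) \<Rightarrow> bool" where
  "entire_exp_type \<sigma> F \<longleftrightarrow>
     F holomorphic_on UNIV \<and>
     (\<forall>\<epsilon>>0. \<exists>C. \<forall>z. norm (F z) \<le> C * exp ((\<sigma> + \<epsilon>) * norm z))"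

definition bernstein_space :: "real \<Rightarrow> (real \<Rightarrow> complex) set" where
  "bernstein_space \<sigma> =
     {\<phi>. bounded (range \<phi>) \<and>
         (\<exists>F. entire_exp_type \<sigma> F \<and> (\<forall>t. F (complex_of_real t) = \<phi> t))}"

text \<open>The normalised cardinal sine; HOL-Probability's \<open>sinc\<close> is real and not normalised.\<close>

definition csinc :: "complex \<Rightarrow> complex" where
  "csinc z = (if z = 0 then 1 else sin (complex_of_real pi * z) / (complex_of_real pi * z))"

end

theory Submission
  imports Defs
begin

text \<open>
  The orbit \<open>t \<mapsto> g (U t f)\<close> has derivatives \<open>g (U t (D\<^sup>k f))\<close>, bounded by a multiple of \<open>\<sigma>\<^sup>k\<close>;
  so it is the restriction of its entire Taylor series \<open>F\<close>, and expanding around \<open>Re z\<close> gives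
  \<open>\<bar>F z\<bar> \<le> M exp (\<sigma> \<bar>Im z\<bar>)\<close>. After rescaling to \<open>\<gamma> = 1\<close>, hence \<open>\<sigma> < \<pi>\<close>, the remainder of the
  cardinal series with nodes \<open>-m, \<dots>, n\<close> is, by the residue theorem, \<open>sin (\<pi> z) / (2 \<pi> \<i>)\<close> times the
  integral of \<open>F w / ((w - z) sin (\<pi> w))\<close> around the rectangle with vertical sides \<open>Re w = -m - 1/2\<close>
  and \<open>Re w = n + 1/2\<close>. As \<open>F w / sin (\<pi> w)\<close> decays like \<open>exp (- (\<pi> - \<sigma>) \<bar>Im w\<bar>)\<close>, the horizontal sides
  vanish as the height grows, and the vertical ones contribute \<open>O(1 / (min m n - \<bar>z\<bar>))\<close>.
\<close>

section \<open>Functions with geometrically bounded derivatives\<close>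

text \<open>The Lagrange remainder of order n is at most
  \<open>M * ((\<sigma> * \<bar>t\<bar>) ^ n / fact n)\<close>, which tends to 0. That form of the
  remainder holds for real functions only, so real and imaginary parts are expanded
  separately.\<close>

lemma bounded_derivatives_taylor_sums:
  fixes \<phi> :: "nat \<Rightarrow> real \<Rightarrow> complex"
  assumes deriv: "\<And>k t. (\<phi> k has_vector_derivative \<phi> (Suc k) t) (at t)"
    and bound: "\<And>k t. norm (\<phi> k t) \<le> M * \<sigma> ^ k"
  shows "(\<lambda>k. \<phi> k c * of_real t ^ k / fact k) sums \<phi> 0 (c + t)"
proof -
  have tendsto0: "(\<lambda>n. M * ((\<sigma> * \<bar>t\<bar>) ^ n / fact n)) \<longlonglongrightarrow> 0"
    by (intro tendsto_mult_right_zero summable_LIMSEQ_zero)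
      (use summable_exp[of "\<sigma> * \<bar>t\<bar>"] in \<open>simp only: divide_inverse_commute\<close>)
  \<comment> \<open>\<open>p\<close> stands for \<open>Re\<close> or \<open>Im\<close>: bounded
    linearity lets it pass through derivatives, and the norm estimate lets it inherit
    \<open>bound\<close>.\<close>
  have real_case: "(\<lambda>k. p (\<phi> k c) * t ^ k / fact k) sums p (\<phi> 0 (c + t))"
    if p: "bounded_linear p" "\<And>z. \<bar>p z\<bar> \<le> norm z" for p :: "complex \<Rightarrow> real"
  proof -
    define diff where "diff k s = p (\<phi> k (c + s))" for k s
    have "(diff m has_real_derivative diff (Suc m) x) (at x)" for m x
    proof -
      have "((\<lambda>s. \<phi> m (c + s)) has_vector_derivative \<phi> (Suc m) (c + x)) (at x)"
        using vector_diff_chain_at[of "\<lambda>s. c + s" 1 x "\<phi> m" "\<phi> (Suc m) (c + x)"]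
          deriv has_real_derivative_iff_has_vector_derivative[of "\<lambda>s. c + s" 1 "at x"]
        by (auto simp: o_def intro!: derivative_eq_intros)
      from bounded_linear.has_vector_derivative[OF p(1) this] show ?thesis
        by (simp add: diff_def[abs_def] has_real_derivative_iff_has_vector_derivative)
    qed
    then have maclaurin: "\<exists>s. \<bar>s\<bar> \<le> \<bar>t\<bar> \<and>
        diff 0 t = (\<Sum>m<n. (diff m 0 / fact m) * t ^ m) + (diff n s / fact n) * t ^ n" for n
      by (intro Maclaurin_all_le) auto
    have "norm ((\<Sum>m<n. diff m 0 * t ^ m / fact m) - diff 0 t) \<le> M * ((\<sigma> * \<bar>t\<bar>) ^ n / fact n)" for n
    proof -
      obtain s where s: "diff 0 t = (\<Sum>m<n. (diff m 0 / fact m) * t ^ m) + (diff n s / fact n) * t ^ n"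
        using maclaurin by blast
      have "\<bar>diff n s\<bar> \<le> M * \<sigma> ^ n"
        using p(2) bound order_trans unfolding diff_def by blast
      then have "\<bar>diff n s\<bar> * (\<bar>t\<bar> ^ n / fact n) \<le> M * \<sigma> ^ n * (\<bar>t\<bar> ^ n / fact n)"
        by (intro mult_right_mono) auto
      then show ?thesis
        by (simp add: s abs_mult power_abs power_mult_distrib)
    qed
    then have "(\<lambda>n. (\<Sum>m<n. diff m 0 * t ^ m / fact m) - diff 0 t) \<longlonglongrightarrow> 0"
      by (intro Lim_null_comparison[OF _ tendsto0] always_eventually allI)
    then show ?thesis
      by (subst (asm) Lim_null[symmetric]) (simp add: sums_def diff_def)
  qed
  have "(\<lambda>k. Re (\<phi> k c) * t ^ k / fact k) sums Re (\<phi> 0 (c + t))"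
    "(\<lambda>k. Im (\<phi> k c) * t ^ k / fact k) sums Im (\<phi> 0 (c + t))"
    by (intro real_case bounded_linear_Re bounded_linear_Im abs_Re_le_cmod abs_Im_le_cmod)+
  moreover have "\<phi> k c * of_real t ^ k / fact k = \<phi> k c * of_real (t ^ k / fact k)" for k
    by simp
  ultimately show ?thesis
    by (simp only: sums_complex_iff times_complex.sel Re_complex_of_real Im_complex_of_real) simp
qed

text \<open>Both claims come from termwise comparison with the exponential series of
  \<open>M * exp (\<sigma> * norm z)\<close>.\<close>

lemma entire_power_series_bounded_coeffs:
  fixes a :: "nat \<Rightarrow> complex"
  assumes bound: "\<And>k. norm (a k) \<le> M * \<sigma> ^ k"
  shows "(\<lambda>z. \<Sum>k. a k * z ^ k / fact k) holomorphic_on UNIV"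
    and "norm (\<Sum>k. a k * z ^ k / fact k) \<le> M * exp (\<sigma> * norm z)"
proof -
  have term_le: "norm (a k * z ^ k / fact k) \<le> M * ((\<sigma> * norm z) ^ k /\<^sub>R fact k)" for z k
    using mult_right_mono[OF bound[of k], of "norm z ^ k / fact k"]
    by (simp add: norm_mult norm_divide norm_power power_mult_distrib field_simps)
  have exp_sums: "(\<lambda>k. M * ((\<sigma> * norm z) ^ k /\<^sub>R fact k)) sums (M * exp (\<sigma> * norm z))" for z
    by (intro sums_mult exp_converges)
  have sums: "(\<lambda>k. a k * z ^ k / fact k) sums (\<Sum>k. a k * z ^ k / fact k)" for z
    by (intro summable_sums summable_comparison_test'[OF sums_summable[OF exp_sums] term_le])
  show "norm (\<Sum>k. a k * z ^ k / fact k) \<le> M * exp (\<sigma> * norm z)"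
    using norm_sums_le[OF sums exp_sums term_le] .
  \<comment> \<open>Holomorphy is obtained on discs; since the radius is arbitrary, every point is
    covered.\<close>
  have "(\<lambda>z. \<Sum>k. a k * z ^ k / fact k) holomorphic_on ball 0 r" for r
    by (rule power_series_holomorphic[where a = "\<lambda>k. a k / fact k"])
      (use sums in \<open>simp add: field_simps\<close>)
  then have "(\<lambda>z. \<Sum>k. a k * z ^ k / fact k) field_differentiable at z" for z
    by (rule holomorphic_on_imp_differentiable_at[of _ "ball 0 (norm z + 1)"]) auto
  then show "(\<lambda>z. \<Sum>k. a k * z ^ k / fact k) holomorphic_on UNIV"
    by (simp add: holomorphic_on_def)
qed

text \<open>The identity theorem applies because the reals accumulate at 0. It serves to identify
  Taylor expansions around different real centres.\<close>

lemma eq_on_reals_imp_eq: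
  assumes "F holomorphic_on UNIV" "G holomorphic_on UNIV"
    and eq: "\<And>t. F (complex_of_real t) = G (complex_of_real t)"
  shows "F z = G z"
proof -
  have "(0::complex) islimpt \<real>"
    unfolding islimpt_approachable
  proof (intro allI impI)
    fix e :: real assume "e > 0"
    then show "\<exists>x'\<in>\<real>. x' \<noteq> (0::complex) \<and> dist x' 0 < e"
      by (intro bexI[of _ "of_real (e / 2)"]) auto
  qed
  then have "F z - G z = 0"
    using analytic_continuation[of "\<lambda>z. F z - G z" UNIV \<real> 0 z] assms
    by (auto simp: Reals_def intro!: holomorphic_intros)
  then show ?thesis by simp
qed

text \<open>On the vertical line through \<open>x\<close> the function equals its Taylor series centred at \<open>x\<close>,
  so only the distance to the real axis enters the bound.\<close>

lemma bounded_derivatives_strip_bound: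
  fixes \<phi> :: "nat \<Rightarrow> real \<Rightarrow> complex"
  assumes deriv: "\<And>k t. (\<phi> k has_vector_derivative \<phi> (Suc k) t) (at t)"
    and bound: "\<And>k t. norm (\<phi> k t) \<le> M * \<sigma> ^ k"
  shows "norm (\<Sum>k. \<phi> k 0 * z ^ k / fact k) \<le> M * exp (\<sigma> * \<bar>Im z\<bar>)"
proof -
  define F where "F c w = (\<Sum>k. \<phi> k c * w ^ k / fact k)" for c w
  note F = entire_power_series_bounded_coeffs[OF bound, folded F_def]
  have real: "F c (of_real t) = \<phi> 0 (c + t)" for c t
    using bounded_derivatives_taylor_sums[OF deriv bound] by (simp add: F_def sums_iff)
  \<comment> \<open>As functions of z with the centre \<open>Re z\<close> frozen, both sides are
    entire and equal \<open>\<phi> 0 t\<close> at every real t.\<close>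
  have "F 0 z = F (Re z) (z - of_real (Re z))"
  proof (rule eq_on_reals_imp_eq[of _ "\<lambda>w. F (Re z) (w - of_real (Re z))"])
    show "(\<lambda>w. F (Re z) (w - of_real (Re z))) holomorphic_on UNIV"
      unfolding F_def
      by (rule holomorphic_on_compose_gen[OF _ entire_power_series_bounded_coeffs(1)[of "\<lambda>k. \<phi> k (Re z)"], OF _ bound, unfolded o_def])
        (auto intro!: holomorphic_intros)
    show "F 0 (complex_of_real t) = F (Re z) (complex_of_real t - complex_of_real (Re z))" for t
      using real[of 0 t] real[of "Re z" "t - Re z"] by simp
  qed (use entire_power_series_bounded_coeffs(1)[of "\<lambda>k. \<phi> k 0", OF bound] in \<open>simp add: F_def\<close>)
  moreover have "norm (z - of_real (Re z)) = \<bar>Im z\<bar>"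
    by (simp add: cmod_def)
  ultimately show ?thesis
    using F(2)[of "\<lambda>_. Re z" "z - of_real (Re z)"] by (simp add: F_def)
qed

section \<open>Orbits of Bernstein vectors\<close>

text \<open>At t = 0 this is the definition of the generator. By the group law the difference
  quotient at t is \<open>U t\<close> applied to the one at 0, and \<open>U t\<close> is continuous.
  Writing the derivative as \<open>U t (D x)\<close> allows iteration with \<open>D x\<close> in
  place of \<open>x\<close>.\<close>

lemma isometry_group_has_vector_derivative:
  assumes U: "isometry_group U" and D: "is_generator U A D" and x: "x \<in> A"
  shows "((\<lambda>t. U t x) has_vector_derivative U t (D x)) (at t)"
proof -
  have lin: "bounded_linear (U t)" and add: "U (t + h) x = U t (U h x)" for h
    using U by (auto simp: isometry_group_def bounded_clinear_def)
  have "((\<lambda>h. U t ((U h x - x) /\<^sub>R h)) \<longlongrightarrow> U t (D x)) (at 0)"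
    using D x by (intro bounded_linear.tendsto[OF lin]) (auto simp: is_generator_def)
  moreover have "U t ((U h x - x) /\<^sub>R h) = (U (t + h) x - U t x) /\<^sub>R h" for h
    by (simp only: add linear_cmul[OF bounded_linear.linear[OF lin]]
        linear_diff[OF bounded_linear.linear[OF lin]])
  ultimately have lim: "((\<lambda>h. (U (t + h) x - U t x) /\<^sub>R h) \<longlongrightarrow> U t (D x)) (at 0)"
    by simp
  then have "((\<lambda>h. norm ((U (t + h) x - U t x) /\<^sub>R h - U t (D x))) \<longlongrightarrow> 0) (at 0)"
    by (intro tendsto_norm_zero) (simp only: Lim_null[symmetric])
  \<comment> \<open>This is the quotient in the definition of the Frechet derivative; it is matched
    with the previous one for nonzero h, hence the eventual equality.\<close>
  then have "((\<lambda>h. norm (U (t + h) x - U t x - h *\<^sub>R U t (D x)) / norm h) \<longlongrightarrow> 0) (at 0)"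
  proof (rule Lim_transform_eventually)
    show "\<forall>\<^sub>F h in at 0. norm ((U (t + h) x - U t x) /\<^sub>R h - U t (D x)) =
        norm (U (t + h) x - U t x - h *\<^sub>R U t (D x)) / norm h"
      unfolding eventually_at_filter
    proof (intro always_eventually allI impI)
      fix h :: real assume "h \<noteq> 0"
      then have "(U (t + h) x - U t x) /\<^sub>R h - U t (D x) =
          (U (t + h) x - U t x - h *\<^sub>R U t (D x)) /\<^sub>R h"
        by (simp add: scaleR_diff_right)
      then show "norm ((U (t + h) x - U t x) /\<^sub>R h - U t (D x)) =
        norm (U (t + h) x - U t x - h *\<^sub>R U t (D x)) / norm h"
        by (simp add: divide_inverse_commute)
    qed
  qed
  then show ?thesis
    by (simp add: has_vector_derivative_def has_derivative_at bounded_linear_scaleR_left)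
qed

lemma funpow_pow_domain:
  "f \<in> pow_domain A D (Suc k) \<Longrightarrow> (D ^^ k) f \<in> A"
proof (induction k arbitrary: f)
  case (Suc k)
  \<comment> \<open>\<open>pow_domain\<close> peels off the innermost \<open>D\<close>, so the
    induction passes from \<open>f\<close> to \<open>D f\<close>.\<close>
  then have "D f \<in> pow_domain A D (Suc k)"
    unfolding pow_domain.simps(2)[of A D "Suc k"] by blast
  from Suc.IH[OF this] show ?case
    by (simp add: funpow_swap1)
qed simp

text \<open>The passage from vectors to scalar functions. Isometry makes the bound uniform in t,
  with M the product of \<open>norm f\<close> and a bound for \<open>g\<close>;
  \<open>U 0 x = x\<close> turns the Taylor coefficients at 0 into the numbers
  \<open>g ((D ^^ k) f)\<close> of the series for \<open>exp_op\<close>.\<close>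

lemma bernstein_vectors_orbit:
  fixes g :: "'a::complex_banach \<Rightarrow> complex"
  assumes U: "isometry_group U" and D: "is_generator U A D"
    and f: "f \<in> bernstein_vectors \<sigma> A D" and g: "bounded_clinear g"
  defines "\<phi> \<equiv> \<lambda>k t. g (U t ((D ^^ k) f))"
  obtains M where "\<And>k t. norm (\<phi> k t) \<le> M * \<sigma> ^ k"
    and "\<And>k t. (\<phi> k has_vector_derivative \<phi> (Suc k) t) (at t)"
    and "\<And>z. g (exp_op z D f) = (\<Sum>k. \<phi> k 0 * z ^ k / fact k)"
proof -
  have g_lin: "bounded_linear g" and g_scale: "g (c *\<^sub>C x) = c * g x" for c x
    using g by (auto simp: bounded_clinear_def scaleC_complex_def)
  obtain K where K: "K \<ge> 0" "\<And>x. norm (g x) \<le> norm x * K"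
    using bounded_linear.nonneg_bounded[OF g_lin] by auto
  have dom: "(D ^^ k) f \<in> A" for k
    using f unfolding bernstein_vectors_def smooth_vectors_def by (blast intro: funpow_pow_domain)
  have "norm (\<phi> k t) \<le> (K * norm f) * \<sigma> ^ k" for k t
  proof -
    \<comment> \<open>The Bernstein inequality is given for k >= 1; for k = 0 it is an
      equality.\<close>
    have "norm ((D ^^ k) f) \<le> \<sigma> ^ k * norm f"
      using f by (cases k) (auto simp: bernstein_vectors_def)
    then have "norm ((D ^^ k) f) * K \<le> \<sigma> ^ k * norm f * K"
      using K(1) by (rule mult_right_mono)
    then show ?thesis
      using K(2)[of "U t ((D ^^ k) f)"] U by (simp add: \<phi>_def isometry_group_def mult_ac)
  qed
  moreover have "(\<phi> k has_vector_derivative \<phi> (Suc k) t) (at t)" for k t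
    using bounded_linear.has_vector_derivative[OF g_lin
        isometry_group_has_vector_derivative[OF U D dom]]
    by (simp add: \<phi>_def)
  moreover have "g (exp_op z D f) = (\<Sum>k. \<phi> k 0 * z ^ k / fact k)" for z
  proof -
    have "g (exp_op z D f) = (\<Sum>k. g ((z ^ k / fact k) *\<^sub>C (D ^^ k) f))"
      unfolding exp_op_def 
      by (rule bounded_linear.suminf[OF g_lin summable_norm_cancel[OF exp_op_summable[OF f]]])
    then show ?thesis
      using U by (simp add: g_scale \<phi>_def isometry_group_def mult_ac)
  qed
  ultimately show thesis by (rule that)
qed

section \<open>The cardinal series\<close>

text \<open>The source is |sin (x + iy)|^2 = (exp (2y) + exp (-2y) - 2 cos (2x)) / 4. The two
  alternatives in the hypothesis serve the vertical and the horizontal sides of the contour.\<close>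

lemma norm_sin_lower_bound:
  assumes "cos (2 * Re z) \<le> 0 \<or> \<bar>Im z\<bar> \<ge> 1"
  shows "exp \<bar>Im z\<bar> / 4 \<le> norm (sin z)"
proof (rule power2_le_imp_le)
  define E where "E = exp (2 * \<bar>Im z\<bar>)"
  have E: "E \<le> exp (2 * Im z) + inverse (exp (2 * Im z))"
    by (cases "Im z \<ge> 0") (auto simp: E_def exp_minus[symmetric])
  \<comment> \<open>Giving 3/4 of E to the cosine leaves E/4, and a quarter of that is the square of
    \<open>exp \<bar>Im z\<bar> / 4\<close>. In the case of a positive cosine, E >= 3 suffices
    because 2 <= 9/4.\<close>
  have "2 * cos (2 * Re z) \<le> 3 / 4 * E"
  proof (cases "cos (2 * Re z) \<le> 0")
    case False
    with assms have "3 \<le> 1 + 2 * \<bar>Im z\<bar>" by simp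
    also have "\<dots> \<le> E" unfolding E_def by (rule exp_ge_add_one_self)
    finally show ?thesis using cos_le_one[of "2 * Re z"] by linarith
  qed (auto simp: E_def intro: order_trans[of _ 0])
  then have "E / 16 \<le> (norm (sin z))\<^sup>2"
    using E unfolding norm_sin_squared by simp
  then show "(exp \<bar>Im z\<bar> / 4)\<^sup>2 \<le> (norm (sin z))\<^sup>2"
    by (simp add: E_def power_divide exp_double[symmetric])
qed simp

text \<open>A weakening of exp u >= 1 + u + u^2/2 at u = 2c|y|. The majorant is chosen because its
  primitive is an arctangent, bounded on the whole line.\<close>

lemma exp_minus_abs_le:
  fixes c y :: real
  assumes "c > 0"
  shows "exp (- (2 * c * \<bar>y\<bar>)) \<le> 1 / (1 + (c * y)\<^sup>2)"
proof -
  have "1 + (c * y)\<^sup>2 \<le> 1 + 2 * c * \<bar>y\<bar> + (2 * c * \<bar>y\<bar>)\<^sup>2 / 2"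
    using assms by (simp add: power_mult_distrib)
  also have "\<dots> \<le> exp (2 * c * \<bar>y\<bar>)"
    using assms by (intro exp_lower_Taylor_quadratic) simp
  finally show ?thesis
    by (simp add: exp_minus field_simps add_pos_nonneg)
qed

text \<open>Bounding by an arctangent makes the estimate uniform in the height of the segment.\<close>

lemma vertical_contour_integral_bound:
  assumes c: "c > 0" and Y: "Y > 0" and B: "B \<ge> 0" and a: "Re a = x" "Im a = - Y" 
    and b: "Re b = x" "Im b = Y"
    and cont: "continuous_on (closed_segment a b) h"
    and bound: "\<And>y. norm (h (Complex x y)) \<le> B / (1 + (c * y)\<^sup>2)"
  shows "norm (contour_integral (linepath a b) h) \<le> B * pi / c"
proof -
  have "h contour_integrable_on linepath a b"
    using cont by (rule contour_integrable_continuous_linepath)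
  \<comment> \<open>On a vertical line dw = i dy; the resulting factor -i does not affect the
    norm.\<close>
  then have h: "((\<lambda>y. h (Complex x y)) has_integral (- \<i> * contour_integral (linepath a b) h)) {- Y..Y}"
    by (subst has_contour_integral_linepath_same_Re_iff[symmetric])
      (use a b Y in \<open>auto simp: has_contour_integral_integral\<close>)
  have deriv: "((\<lambda>y. B / c * arctan (c * y)) has_real_derivative B / (1 + (c * y)\<^sup>2)) (at y within S)" for y S
    using c by (auto intro!: derivative_eq_intros simp: divide_inverse)
  have majorant: "((\<lambda>y. B / (1 + (c * y)\<^sup>2)) has_integral
      (B / c * arctan (c * Y) - B / c * arctan (c * (- Y)))) {- Y..Y}"
    by (rule fundamental_theorem_of_calculus)
      (use Y deriv in \<open>auto simp flip: has_real_derivative_iff_has_vector_derivative\<close>)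
  have "norm (contour_integral (linepath a b) h) = norm (integral {- Y..Y} (\<lambda>y. h (Complex x y)))"
    by (simp add: integral_unique[OF h] norm_mult)
  also have "\<dots> \<le> integral {- Y..Y} (\<lambda>y. B / (1 + (c * y)\<^sup>2))"
    by (rule integral_norm_bound_integral[OF has_integral_integrable[OF h]
          has_integral_integrable[OF majorant] bound])
  also have "\<dots> = B / c * (2 * arctan (c * Y))"
    by (simp add: integral_unique[OF majorant] arctan_minus)
  also have "\<dots> \<le> B / c * pi"
    using arctan_ubound[of "c * Y"] B c by (intro mult_left_mono) auto
  finally show ?thesis by simp
qed

section \<open>Cardinal partial sums and their interpolation property\<close>

lemma sin_pi_eq_0_iff: "sin (complex_of_real pi * z) = 0 \<longleftrightarrow> z \<in> \<int>"
  by (auto simp: sin_eq_0 Ints_def mult.commute)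

text \<open>The sign cos (pi k) is its own inverse and sin (pi (z - k)) = sin (pi z) cos (pi k). The
  left-hand side is the quotient that the residue at k produces.\<close>

lemma sin_pi_mult_eq_csinc:
  assumes "z \<notin> \<int>"
  shows "sin (complex_of_real pi * z) / (complex_of_real pi * cos (complex_of_real pi * of_int k) * (z - of_int k))
     = csinc (z - of_int k)"
proof -
  have "z - of_int k \<noteq> 0" using assms by auto
  have sin0: "sin (complex_of_real pi * of_int k) = 0"
    by (simp add: sin_pi_eq_0_iff)
  define C where "C = cos (complex_of_real pi * of_int k)"
  have "C * C = 1"
    using sin_cos_squared_add[of "complex_of_real pi * of_int k"] sin0
    by (simp add: C_def power2_eq_square)
  then have "C \<noteq> 0" "inverse C = C"
    by (auto intro: inverse_unique)
  moreover have "sin (complex_of_real pi * (z - of_int k)) = sin (complex_of_real pi * z) * C"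
    by (simp add: right_diff_distrib sin_diff C_def sin0)
  ultimately show ?thesis
    using \<open>z - of_int k \<noteq> 0\<close> by (simp add: csinc_def C_def[symmetric] divide_inverse)
qed

text \<open>The two ends vary independently, so that the limit is that of a two-sided series and not
  merely of its symmetric sums.\<close>

definition cardinal_partial_sum :: "(complex \<Rightarrow> complex) \<Rightarrow> nat \<Rightarrow> nat \<Rightarrow> complex \<Rightarrow> complex" where
  "cardinal_partial_sum F m n z = (\<Sum>k = - int m..int n. F (of_int k) * csinc (z - of_int k))"

lemma csinc_of_int: "csinc (of_int k) = (if k = 0 then 1 else 0)"
  by (simp add: csinc_def sin_pi_eq_0_iff)

text \<open>Covers integer arguments, where the contour argument fails: the pole at z merges with a
  node, and sin (pi z) cannot be divided by.\<close>

lemma cardinal_partial_sum_of_int: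
  assumes "- int m \<le> j" "j \<le> int n"
  shows "cardinal_partial_sum F m n (of_int j) = F (of_int j)"
proof -
  have "cardinal_partial_sum F m n (of_int j) =
      (\<Sum>k = - int m..int n. if k = j then F (of_int j) else 0)"
    unfolding cardinal_partial_sum_def
    by (intro sum.cong) (auto simp: csinc_of_int simp flip: of_int_diff)
  then show ?thesis
    using assms by simp
qed

section \<open>Residues and the contour integral over a rectangle\<close>

definition sampling_integrand :: "(complex \<Rightarrow> complex) \<Rightarrow> complex \<Rightarrow> complex \<Rightarrow> complex" where
  "sampling_integrand F z w = F w / ((w - z) * sin (complex_of_real pi * w))"

lemma sampling_integrand_holomorphic:
  assumes "F holomorphic_on UNIV"
  shows "sampling_integrand F z holomorphic_on - insert z \<int>"
  unfolding sampling_integrand_def using assms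
  by (intro holomorphic_intros) (auto simp: sin_pi_eq_0_iff intro: holomorphic_on_subset)

text \<open>The singularities are at most simple poles: z is not an integer, and sin (pi w) has the
  nonzero derivative pi cos (pi k) at k.\<close>

lemma residue_sampling_integrand:
  assumes F: "F holomorphic_on UNIV" and z: "z \<notin> \<int>"
  shows "residue (sampling_integrand F z) z = F z / sin (complex_of_real pi * z)"
    and "residue (sampling_integrand F z) (of_int k) =
      - (F (of_int k) * csinc (z - of_int k)) / sin (complex_of_real pi * z)"
proof -
  have "residue (\<lambda>w. F w / sin (complex_of_real pi * w) / (w - z)) z = F z / sin (complex_of_real pi * z)"
    using F z
    by (intro residue_simple[of "- \<int>"] holomorphic_intros)
      (auto simp: sin_pi_eq_0_iff open_Compl intro: holomorphic_on_subset)
  then show "residue (sampling_integrand F z) z = F z / sin (complex_of_real pi * z)"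
    by (simp add: sampling_integrand_def[abs_def] mult.commute)
next
  define C where "C = complex_of_real pi * cos (complex_of_real pi * of_int k)"
  \<comment> \<open>An open neighbourhood of k that omits z and all other integers.\<close>
  define T where "T = - insert z (complex_of_int ` (UNIV - {k}))"
  have sin0: "sin (complex_of_real pi * of_int k) = 0"
    by (simp add: sin_pi_eq_0_iff)
  have "C \<noteq> 0"
    using sin_cos_squared_add[of "complex_of_real pi * of_int k"] sin0 by (auto simp: C_def)
  have "((\<lambda>w. sin (complex_of_real pi * w)) has_field_derivative C) (at (of_int k))"
    by (auto intro!: derivative_eq_intros simp: C_def)
  then have "((\<lambda>w. sin (complex_of_real pi * w) / (w - of_int k)) \<longlongrightarrow> C) (at (of_int k))"
    by (simp add: has_field_derivative_iff sin0)
  moreover have "(F \<longlongrightarrow> F (of_int k)) (at (of_int k))"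
    using holomorphic_on_imp_continuous_on[OF F] by (simp add: continuous_on_def)
  ultimately have lim: "((\<lambda>w. F w / ((w - z) * (sin (complex_of_real pi * w) / (w - of_int k))))
      \<longlongrightarrow> F (of_int k) / ((of_int k - z) * C)) (at (of_int k))"
    using z \<open>C \<noteq> 0\<close> by (intro tendsto_intros) auto
  have "residue (sampling_integrand F z) (of_int k) = F (of_int k) / ((of_int k - z) * C)"
  proof (rule residue_simple'[of T])
    show "open T"
      unfolding T_def by (intro open_Compl closed_insert closed_of_int_image)
    show "of_int k \<in> T"
      using z by (auto simp: T_def)
    have "T - {of_int k} \<subseteq> - insert z \<int>"
      by (auto simp: T_def Ints_def)
    then show "sampling_integrand F z holomorphic_on T - {of_int k}"
      using sampling_integrand_holomorphic[OF F] holomorphic_on_subset by blast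
    show "((\<lambda>w. sampling_integrand F z w * (w - of_int k)) \<longlongrightarrow> F (of_int k) / ((of_int k - z) * C))
        (at (of_int k))"
      using lim by (simp add: sampling_integrand_def)
  qed
  \<comment> \<open>Turning k - z into z - k yields the minus sign that makes the residues add up to
    a difference.\<close>
  also have "\<dots> = - (F (of_int k) / (C * (z - of_int k)))"
    by (metis minus_diff_eq minus_divide_right mult.commute mult_minus_right)
  also have "\<dots> = - (F (of_int k) * csinc (z - of_int k)) / sin (complex_of_real pi * z)"
    using z by (simp flip: sin_pi_mult_eq_csinc add: C_def sin_pi_eq_0_iff)
  finally show "residue (sampling_integrand F z) (of_int k) =
      - (F (of_int k) * csinc (z - of_int k)) / sin (complex_of_real pi * z)" .
qed

lemma contour_integral_sampling_integrand:
  fixes m n :: nat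
  assumes F: "F holomorphic_on UNIV" and z: "z \<notin> \<int>"
    and a: "a = Complex (- real m - 1 / 2) (- Y)" and b: "b = Complex (real n + 1 / 2) Y"
    and Y: "Y > 0" and z_box: "z \<in> box a b"
  shows "contour_integral (rectpath a b) (sampling_integrand F z) =
    2 * pi * \<i> * ((F z - cardinal_partial_sum F m n z) / sin (complex_of_real pi * z))"
proof -
  \<comment> \<open>The margin 3/4 lies between 1/2 and 1: the strip contains the closed rectangle
    but no integers other than -m, ..., n.\<close>
  define S where "S = {w. Re w > - real m - 3 / 4} \<inter> {w. Re w < real n + 3 / 4}"
  define ks where "ks = {- int m..int n}"
  define pts where "pts = insert z (of_int ` ks)"
  have "open S"
    unfolding S_def by (intro open_Int open_halfspace_Re_gt open_halfspace_Re_lt)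
  moreover have "connected S"
    unfolding S_def by (intro convex_connected convex_Int convex_halfspace_Re_gt convex_halfspace_Re_lt)
  moreover have "sampling_integrand F z holomorphic_on S - pts"
  proof (rule holomorphic_on_subset[OF sampling_integrand_holomorphic[OF F]])
    show "S - pts \<subseteq> - insert z \<int>"
      by (auto simp: S_def pts_def ks_def Ints_def)
  qed
  moreover have pts_box: "pts \<subseteq> box a b"
    using z_box Y by (auto simp: pts_def ks_def a b in_box_complex_iff)
  moreover have rect: "cbox a b \<subseteq> S" "path_image (rectpath a b) = cbox a b - box a b"
    using Y by (auto simp: a b S_def in_cbox_complex_iff path_image_rectpath_cbox_minus_box)
  moreover have "winding_number (rectpath a b) w = 0" if "w \<notin> S" for w
    using that rect Y by (intro winding_number_rectpath_outside) (auto simp: a b)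
  ultimately have "contour_integral (rectpath a b) (sampling_integrand F z) =
      2 * pi * \<i> * (\<Sum>p\<in>pts. winding_number (rectpath a b) p * residue (sampling_integrand F z) p)"
    by (intro Residue_theorem) (auto simp: pts_def ks_def)
  also have "(\<Sum>p\<in>pts. winding_number (rectpath a b) p * residue (sampling_integrand F z) p) =
      (\<Sum>p\<in>pts. residue (sampling_integrand F z) p)"
    using pts_box by (intro sum.cong) (auto simp: winding_number_rectpath)
  also have "\<dots> = residue (sampling_integrand F z) z +
      (\<Sum>k\<in>ks. residue (sampling_integrand F z) (of_int k))"
    using z unfolding pts_def
    by (subst sum.insert) (auto simp: ks_def sum.reindex inj_on_def)
  also have "\<dots> = (F z - cardinal_partial_sum F m n z) / sin (complex_of_real pi * z)"
    by (simp add: residue_sampling_integrand[OF F z] cardinal_partial_sum_def ks_def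
        diff_divide_distrib sum_negf flip: sum_divide_distrib)
  finally show ?thesis .
qed

section \<open>Remainder estimates for growth rate below pi in the imaginary direction\<close>

context
  fixes F :: "complex \<Rightarrow> complex" and M \<tau> c :: real
  assumes F: "F holomorphic_on UNIV"
    and growth: "\<And>w. norm (F w) \<le> M * exp (\<tau> * \<bar>Im w\<bar>)"
    and \<tau>: "\<tau> < pi"
  defines "c \<equiv> (pi - \<tau>) / 2"
begin

lemma c_pos: "c > 0" and M_nonneg: "M \<ge> 0"
  using \<tau> order_trans[OF norm_ge_zero growth[of 0]] by (simp_all add: c_def)

text \<open>The quotient of \<open>exp (\<tau> * \<bar>Im w\<bar>)\<close> by the lower bound for
  the sine decays at rate \<open>pi - \<tau>\<close>, which is \<open>2 * c\<close>, the form
  required by \<open>exp_minus_abs_le\<close>.\<close>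

lemma sampling_integrand_bound:
  assumes w: "cos (2 * pi * Re w) \<le> 0 \<or> \<bar>Im w\<bar> \<ge> 1" and d: "d > 0" "d \<le> norm (w - z)"
  shows "norm (sampling_integrand F z w) \<le> 4 * M / d / (1 + (c * Im w)\<^sup>2)"
proof -
  have "exp (pi * \<bar>Im w\<bar>) / 4 \<le> norm (sin (complex_of_real pi * w))"
  proof -
    have "\<bar>Im w\<bar> \<ge> 1 \<Longrightarrow> pi * \<bar>Im w\<bar> \<ge> 1 * 1"
      using pi_gt3 by (intro mult_mono) auto
    then show ?thesis
      using norm_sin_lower_bound[of "complex_of_real pi * w"] w
      by (auto simp: abs_mult mult.assoc)
  qed
  then have "norm (F w) / norm (sin (complex_of_real pi * w))
      \<le> M * exp (\<tau> * \<bar>Im w\<bar>) / (exp (pi * \<bar>Im w\<bar>) / 4)"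
    using growth M_nonneg by (intro frac_le) auto
  also have "\<dots> = 4 * M * exp (- (2 * c * \<bar>Im w\<bar>))"
    by (simp add: c_def exp_minus exp_diff algebra_simps diff_divide_distrib)
  also have "\<dots> \<le> 4 * M * (1 / (1 + (c * Im w)\<^sup>2))"
    using c_pos M_nonneg by (intro mult_left_mono exp_minus_abs_le) auto
  finally have "norm (F w) / norm (sin (complex_of_real pi * w)) / norm (w - z)
      \<le> 4 * M * (1 / (1 + (c * Im w)\<^sup>2)) / d"
    using d M_nonneg by (intro frac_le) (auto simp: add_nonneg_eq_0_iff)
  then show ?thesis
    by (simp add: sampling_integrand_def norm_divide norm_mult mult_ac)
qed

text \<open>The first summand comes from the two vertical sides, at distance at least
  \<open>min m n - R\<close> from z; the second from the two horizontal sides of length m + n + 1.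
  The condition on Y keeps the latter at distance at least 1 both from z and from the real
  axis.\<close>

lemma sampling_rectangle_bound:
  fixes m n :: nat
  assumes z: "z \<notin> \<int>" and R: "norm z \<le> R" "R < real m" "R < real n" and Y: "Y \<ge> R + 1"
  shows "norm (2 * pi * \<i> * ((F z - cardinal_partial_sum F m n z) / sin (complex_of_real pi * z)))
    \<le> 8 * M * pi / (c * (real (min m n) - R)) + 8 * M * (real m + real n + 1) / (1 + (c * Y)\<^sup>2)"
proof -
  define d where "d = real (min m n) - R"
  define a1 a2 a3 a4 where "a1 = Complex (- real m - 1 / 2) (- Y)" and "a2 = Complex (real n + 1 / 2) (- Y)"
    and "a3 = Complex (real n + 1 / 2) Y" and "a4 = Complex (- real m - 1 / 2) Y"
  note a_defs = a1_def a2_def a3_def a4_def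
  define h where "h = sampling_integrand F z"
  have d: "d > 0" using R by (simp add: d_def)
  have Re_Im: "\<bar>Re z\<bar> \<le> R" "\<bar>Im z\<bar> \<le> R" "R \<ge> 0"
    using R(1) abs_Re_le_cmod[of z] abs_Im_le_cmod[of z] by (auto intro: order_trans)
  have box: "z \<in> box a1 a3"
    using Re_Im R Y by (auto simp: a1_def a3_def in_box_complex_iff)
  have cos_half: "cos (2 * pi * (real k + 1 / 2)) = - 1" for k
    using cos_periodic_pi[of "2 * real k * pi"] cos_2npi[of k] by (simp add: algebra_simps)
  have vertical: "norm (h w) \<le> 4 * M / d / (1 + (c * Im w)\<^sup>2)"
    if "Re w = real n + 1 / 2 \<or> Re w = - real m - 1 / 2" for w
    unfolding h_def
  proof (rule sampling_integrand_bound)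
    have "cos (2 * pi * (- real m - 1 / 2)) = cos (2 * pi * (real m + 1 / 2))"
      by (subst cos_minus[symmetric]) (simp add: algebra_simps)
    then have "cos (2 * pi * Re w) = - 1"
      using that cos_half by auto
    then show "cos (2 * pi * Re w) \<le> 0 \<or> \<bar>Im w\<bar> \<ge> 1"
      by simp
    show "d \<le> norm (w - z)"
      using abs_Re_le_cmod[of "w - z"] that Re_Im by (auto simp: d_def)
  qed (rule d)
  have horizontal: "norm (h w) \<le> 4 * M / (1 + (c * Y)\<^sup>2)" if "\<bar>Im w\<bar> = Y" for w
  proof -
    have "norm (h w) \<le> 4 * M / 1 / (1 + (c * Im w)\<^sup>2)"
      unfolding h_def
      by (rule sampling_integrand_bound)
        (use abs_Im_le_cmod[of "w - z"] that Re_Im Y in auto)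
    also have "(c * Im w)\<^sup>2 = (c * Y)\<^sup>2"
      using that by (metis abs_mult_self_eq power2_eq_square power_mult_distrib)
    finally show ?thesis by simp
  qed
  have off: "w \<in> - insert z \<int>"
    if w: "Re w = real n + 1 / 2 \<or> Re w = - real m - 1 / 2 \<or> \<bar>Im w\<bar> = Y" for w
  proof -
    have "w \<noteq> of_int k" for k
    proof
      assume "w = of_int k"
      \<comment> \<open>Horizontal sides contain no integers because Y > 0; on vertical sides,
        doubling the real part would equate an even and an odd integer.\<close>
      then have "2 * real_of_int k = real_of_int (2 * int n + 1) \<or>
          2 * real_of_int k = real_of_int (- 2 * int m - 1)"
        using w Y Re_Im by auto
      then have "2 * k = 2 * int n + 1 \<or> 2 * k = - 2 * int m - 1"
        by linarith
      then show False by presburger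
    qed
    moreover have "w \<noteq> z"
      using w Re_Im R Y by auto
    ultimately show ?thesis
      by (auto simp: Ints_def)
  qed
  have bdry: "closed_segment a1 a2 \<subseteq> - insert z \<int>" "closed_segment a2 a3 \<subseteq> - insert z \<int>"
    "closed_segment a3 a4 \<subseteq> - insert z \<int>" "closed_segment a4 a1 \<subseteq> - insert z \<int>"
    using off Re_Im Y by (auto simp: a_defs closed_segment_same_Re closed_segment_same_Im)
  have cont: "continuous_on A h" if "A \<subseteq> - insert z \<int>" for A
    using continuous_on_subset[OF holomorphic_on_imp_continuous_on[OF sampling_integrand_holomorphic[OF F]] that]
    by (simp add: h_def)
  have cis: "h contour_integrable_on linepath a1 a2" "h contour_integrable_on linepath a2 a3"
    "h contour_integrable_on linepath a3 a4" "h contour_integrable_on linepath a4 a1"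
    using bdry cont by (auto intro!: contour_integrable_continuous_linepath)
  have horizontal_integral: "norm (contour_integral (linepath u v) h) \<le> 4 * M / (1 + (c * Y)\<^sup>2) * (real m + real n + 1)"
    if "h contour_integrable_on linepath u v" "Im u = Im v" "\<bar>Im v\<bar> = Y"
      "\<bar>Re v - Re u\<bar> = real m + real n + 1" for u v
  proof -
    have "norm (v - u) = real m + real n + 1"
      using that by (simp add: cmod_def)
    moreover have "norm (contour_integral (linepath u v) h) \<le> 4 * M / (1 + (c * Y)\<^sup>2) * norm (v - u)"
      using that M_nonneg
      by (intro contour_integral_bound_linepath horizontal)
        (auto simp: closed_segment_same_Im add_nonneg_nonneg)
    ultimately show ?thesis by simp
  qed
  have "norm (contour_integral (linepath a2 a3) h) \<le> 4 * M / d * pi / c"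
    by (rule vertical_contour_integral_bound[where x = "real n + 1 / 2" and Y = Y])
      (use c_pos d M_nonneg Re_Im Y vertical[of "Complex (real n + 1 / 2) _"] cont bdry in \<open>auto simp: a_defs\<close>)
  \<comment> \<open>The left side is traversed downwards, so it is reversed before the bound for
    upward segments is applied.\<close>
  moreover have "norm (contour_integral (linepath a4 a1) h) \<le> 4 * M / d * pi / c"
    unfolding contour_integral_reverse_linepath[OF cont[OF bdry(4)]] norm_minus_cancel
    by (rule vertical_contour_integral_bound[where x = "- real m - 1 / 2" and Y = Y])
      (use c_pos d M_nonneg Re_Im Y vertical[of "Complex (- real m - 1 / 2) _"] cont bdry
        in \<open>auto simp: a_defs closed_segment_commute\<close>)
  moreover have "norm (contour_integral (linepath a1 a2) h) \<le> 4 * M / (1 + (c * Y)\<^sup>2) * (real m + real n + 1)"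
    "norm (contour_integral (linepath a3 a4) h) \<le> 4 * M / (1 + (c * Y)\<^sup>2) * (real m + real n + 1)"
    by (rule horizontal_integral; use cis Re_Im Y in \<open>simp add: a_defs\<close>)+
  moreover have "contour_integral (rectpath a1 a3) h = contour_integral (linepath a1 a2) h +
      (contour_integral (linepath a2 a3) h + (contour_integral (linepath a3 a4) h +
        contour_integral (linepath a4 a1) h))"
    using cis by (simp add: rectpath_def Let_def a1_def a3_def flip: a2_def a4_def)
  ultimately have "norm (contour_integral (rectpath a1 a3) h) \<le>
      4 * M / (1 + (c * Y)\<^sup>2) * (real m + real n + 1) + (4 * M / d * pi / c +
      (4 * M / (1 + (c * Y)\<^sup>2) * (real m + real n + 1) + 4 * M / d * pi / c))"
    by (simp only:) (intro norm_triangle_mono)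
  also have "\<dots> = 8 * M * pi / (c * d) + 8 * M * (real m + real n + 1) / (1 + (c * Y)\<^sup>2)"
    by (simp add: mult_ac)
  finally show ?thesis
    using contour_integral_sampling_integrand[OF F z a1_def a3_def _ box] Re_Im Y
    by (simp add: h_def d_def)
qed

text \<open>For z not an integer, m and n stay fixed while Y tends to infinity, which leaves only
  the vertical contribution. At integers both sides are 0.\<close>

lemma sampling_remainder_bound:
  fixes m n :: nat
  assumes R: "norm z \<le> R" "R < real m" "R < real n"
  shows "norm (F z - cardinal_partial_sum F m n z)
    \<le> norm (sin (complex_of_real pi * z)) * (4 * M / c / (real (min m n) - R))"
proof (cases "z \<in> \<int>")
  case True
  then obtain j where j: "z = of_int j" by (auto simp: Ints_def)
  then have "- int m \<le> j" "j \<le> int n"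
    using R by auto
  moreover have "sin (complex_of_real pi * of_int j) = 0"
    by (simp add: sin_pi_eq_0_iff)
  ultimately show ?thesis
    unfolding j by (simp only: cardinal_partial_sum_of_int norm_zero diff_self mult_zero_left order_refl)
next
  case False
  let ?X = "norm (2 * pi * \<i> * ((F z - cardinal_partial_sum F m n z) / sin (complex_of_real pi * z)))"
  have "((\<lambda>Y. 8 * M * pi / (c * (real (min m n) - R)) + 8 * M * (real m + real n + 1) / (1 + (c * Y)\<^sup>2))
      \<longlongrightarrow> 8 * M * pi / (c * (real (min m n) - R)) + 0) at_top"
    using c_pos
    by (intro tendsto_add tendsto_const tendsto_divide_0[OF tendsto_const]
        filterlim_at_top_imp_at_infinity filterlim_tendsto_add_at_top[OF tendsto_const]
        filterlim_pow_at_top filterlim_tendsto_pos_mult_at_top[OF tendsto_const] filterlim_ident) auto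
  moreover have "\<forall>\<^sub>F Y in at_top. ?X
      \<le> 8 * M * pi / (c * (real (min m n) - R)) + 8 * M * (real m + real n + 1) / (1 + (c * Y)\<^sup>2)"
    using eventually_ge_at_top sampling_rectangle_bound[OF False R] by (rule eventually_mono)
  ultimately have "?X \<le> 8 * M * pi / (c * (real (min m n) - R)) + 0"
    by (rule tendsto_lowerbound) simp
  moreover have "?X = 2 * pi * (norm (F z - cardinal_partial_sum F m n z) / norm (sin (complex_of_real pi * z)))"
    by (simp add: norm_mult norm_divide)
  moreover have "8 * M * pi / (c * (real (min m n) - R)) + 0 = 2 * pi * (4 * M / c / (real (min m n) - R))"
    by simp
  ultimately have "norm (F z - cardinal_partial_sum F m n z) / norm (sin (complex_of_real pi * z))
      \<le> 4 * M / c / (real (min m n) - R)"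
    by (metis mult_le_cancel_left_pos pi_gt_zero mult_pos_pos zero_less_numeral)
  moreover have "norm (sin (complex_of_real pi * z)) > 0"
    using False by (simp add: sin_pi_eq_0_iff)
  ultimately show ?thesis
    by (simp only: pos_divide_le_eq mult.commute)
qed

text \<open>On K the norm of z and the sine are bounded, and the remainder bound depends on m and n
  through \<open>min m n\<close> only; hence one threshold serves both indices.\<close>

lemma uniform_limit_cardinal_partial_sum:
  assumes K: "compact K"
  shows "uniform_limit K (\<lambda>(m, n). cardinal_partial_sum F m n) F (sequentially \<times>\<^sub>F sequentially)"
proof -
  obtain R where R: "\<And>z. z \<in> K \<Longrightarrow> norm z \<le> R"
    using compact_imp_bounded[OF K] by (auto simp: bounded_iff)
  have "compact ((\<lambda>z. sin (complex_of_real pi * z)) ` K)"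
    using K by (intro compact_continuous_image continuous_intros)
  then obtain L where L: "\<And>z. z \<in> K \<Longrightarrow> norm (sin (complex_of_real pi * z)) \<le> L"
    using compact_imp_bounded by (fastforce simp: bounded_iff)
  show ?thesis
    unfolding uniform_limit_iff
  proof (intro allI impI)
    fix e :: real assume e: "e > 0"
    have top: "filterlim (\<lambda>N. - R + real N) at_top sequentially"
      by (intro filterlim_tendsto_add_at_top[OF tendsto_const] filterlim_real_sequentially)
    have "(\<lambda>N::nat. \<bar>L\<bar> * (4 * M / c / (- R + real N))) \<longlonglongrightarrow> 0"
      by (intro tendsto_mult_right_zero tendsto_divide_0[OF tendsto_const]
          filterlim_at_top_imp_at_infinity[OF top])
    then have "eventually (\<lambda>N. \<bar>L\<bar> * (4 * M / c / (real N - R)) < e) sequentially"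
      using e order_tendstoD(2) by fastforce
    moreover have "eventually (\<lambda>N. real N > R) sequentially"
      using filterlim_real_sequentially unfolding filterlim_at_top_dense by blast
    ultimately have "eventually (\<lambda>N. \<bar>L\<bar> * (4 * M / c / (real N - R)) < e \<and> real N > R) sequentially"
      by (rule eventually_conj)
    then obtain N0 where N0: "\<And>N. N \<ge> N0 \<Longrightarrow> \<bar>L\<bar> * (4 * M / c / (real N - R)) < e"
      "\<And>N. N \<ge> N0 \<Longrightarrow> real N > R"
      by (auto simp: eventually_sequentially)
    have "dist (cardinal_partial_sum F m n z) (F z) < e" if mn: "m \<ge> N0" "n \<ge> N0" and z: "z \<in> K" for m n z
    proof -
      have "norm (F z - cardinal_partial_sum F m n z)
          \<le> norm (sin (complex_of_real pi * z)) * (4 * M / c / (real (min m n) - R))"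
        using R z N0(2) mn by (intro sampling_remainder_bound) auto
      also have "\<dots> \<le> \<bar>L\<bar> * (4 * M / c / (real (min m n) - R))"
        using L[OF z] N0(2)[of "min m n"] mn c_pos M_nonneg by (intro mult_right_mono) auto
      also have "\<dots> < e"
        using N0(1)[of "min m n"] mn by simp
      finally show ?thesis
        by (simp add: dist_norm norm_minus_commute)
    qed
    then show "\<forall>\<^sub>F p in sequentially \<times>\<^sub>F sequentially. \<forall>z\<in>K.
        dist ((case p of (m, n) \<Rightarrow> cardinal_partial_sum F m n) z) (F z) < e"
      unfolding eventually_prod_sequentially by auto
  qed
qed

end

section \<open>The sampling theorem\<close>

text \<open>The condition \<open>\<gamma> * \<sigma> < pi\<close> places the sampling rate above the
  critical one: for \<open>\<gamma> * \<sigma> = pi\<close> the function sin (pi z / \<gamma>) has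
  type \<sigma>, is bounded on the real line and vanishes at every node. The product filter
  expresses convergence of the two-sided series.\<close>

theorem theorem8p1:
  fixes U :: "real \<Rightarrow> 'a::complex_banach \<Rightarrow> 'a"
    and dom :: "'a set" and D :: "'a \<Rightarrow> 'a"
    and \<sigma> :: real and f :: 'a and g :: "'a \<Rightarrow> complex"
  assumes "isometry_group U"
    and "is_generator U dom D"
    and "\<sigma> \<ge> 0"
    and "f \<in> bernstein_vectors \<sigma> dom D"
    and "bounded_clinear g"
  shows "(\<lambda>t. g (U t f)) \<in> bernstein_space \<sigma> \<and>
         entire_exp_type \<sigma> (\<lambda>z. g (exp_op z D f)) \<and>
         (\<forall>t. g (exp_op (complex_of_real t) D f) = g (U t f)) \<and>
         (\<forall>\<gamma>. 0 < \<gamma> \<and> \<gamma> < 1 \<and> \<gamma> * \<sigma> < pi \<longrightarrow>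
           (\<forall>z. ((\<lambda>(m, n). \<Sum>k = - int m..int n.
                    g (U (\<gamma> * of_int k) f) * csinc (z / complex_of_real \<gamma> - of_int k))
                  \<longlongrightarrow> g (exp_op z D f)) (sequentially \<times>\<^sub>F sequentially)) \<and>
           (\<forall>K. compact K \<longrightarrow>
              uniform_limit K
                (\<lambda>(m, n) z. \<Sum>k = - int m..int n.
                    g (U (\<gamma> * of_int k) f) * csinc (z / complex_of_real \<gamma> - of_int k))
                (\<lambda>z. g (exp_op z D f)) (sequentially \<times>\<^sub>F sequentially)))"
proof -
  define \<phi> where "\<phi> k t = g (U t ((D ^^ k) f))" for k t
  define F where "F z = g (exp_op z D f)" for z
  obtain M where bound: "\<And>k t. norm (\<phi> k t) \<le> M * \<sigma> ^ k"
    and deriv: "\<And>k t. (\<phi> k has_vector_derivative \<phi> (Suc k) t) (at t)"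
    and F_series: "\<And>z. F z = (\<Sum>k. \<phi> k 0 * z ^ k / fact k)"
    using bernstein_vectors_orbit[OF assms(1,2,4,5)] unfolding \<phi>_def[abs_def] F_def by blast
  have F_holo: "F holomorphic_on UNIV" and F_exp: "norm (F z) \<le> M * exp (\<sigma> * norm z)" for z
    using entire_power_series_bounded_coeffs(1,2)[of "\<lambda>k. \<phi> k 0", OF bound]
    by (simp_all add: F_series[abs_def])
  have F_strip: "norm (F z) \<le> M * exp (\<sigma> * \<bar>Im z\<bar>)" for z
    using bounded_derivatives_strip_bound[OF deriv bound] by (simp add: F_series)
  have F_real: "F (of_real t) = g (U t f)" for t
    using bounded_derivatives_taylor_sums[OF deriv bound, of 0 t]
    by (simp add: F_series sums_iff) (simp add: \<phi>_def)
  have M: "M \<ge> 0"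
    using order_trans[OF norm_ge_zero bound[of 0 0]] by simp
  have F_type: "entire_exp_type \<sigma> F"
    unfolding entire_exp_type_def
  proof (intro conjI allI impI exI)
    show "norm (F z) \<le> M * exp ((\<sigma> + \<epsilon>) * norm z)" if "\<epsilon> > 0" for z \<epsilon>
      by (rule order_trans[OF F_exp]) (use that M in \<open>intro mult_left_mono, auto simp: mult_right_mono\<close>)
  qed (rule F_holo)
  have "norm (g (U t f)) \<le> M" for t
    using bound[of 0 t] by (simp add: \<phi>_def)
  then have "bounded (range (\<lambda>t. g (U t f)))"
    by (auto simp: bounded_iff)
  then have space: "(\<lambda>t. g (U t f)) \<in> bernstein_space \<sigma>"
    unfolding bernstein_space_def using F_type F_real by blast
  have sampling: "uniform_limit K
      (\<lambda>(m, n) z. \<Sum>k = - int m..int n. g (U (\<gamma> * of_int k) f) * csinc (z / complex_of_real \<gamma> - of_int k))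
      F (sequentially \<times>\<^sub>F sequentially)"
    if \<gamma>: "0 < \<gamma>" "\<gamma> * \<sigma> < pi" and K: "compact K" for \<gamma> K
  proof -
    \<comment> \<open>The nodes \<gamma> k become integers, and the growth rate \<sigma> becomes
      \<open>\<gamma> * \<sigma>\<close>, which is below pi.\<close>
    define G where "G w = F (of_real \<gamma> * w)" for w
    have "G holomorphic_on UNIV"
      using holomorphic_on_compose_gen[OF _ F_holo, of "\<lambda>w. of_real \<gamma> * w" UNIV]
      by (simp add: o_def G_def[abs_def] holomorphic_on_mult)
    moreover have "norm (G w) \<le> M * exp ((\<gamma> * \<sigma>) * \<bar>Im w\<bar>)" for w
      using F_strip[of "of_real \<gamma> * w"] \<gamma> by (simp add: G_def abs_mult mult_ac)
    moreover have "compact ((\<lambda>z. z / of_real \<gamma>) ` K)"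
      using K \<gamma> by (intro compact_continuous_image continuous_intros) auto
    ultimately have "uniform_limit ((\<lambda>z. z / of_real \<gamma>) ` K) (\<lambda>(m, n). cardinal_partial_sum G m n) G
        (sequentially \<times>\<^sub>F sequentially)"
      using \<gamma> by (intro uniform_limit_cardinal_partial_sum)
    then have "uniform_limit K (\<lambda>p z. (case p of (m, n) \<Rightarrow> cardinal_partial_sum G m n) (z / of_real \<gamma>))
        (\<lambda>z. G (z / of_real \<gamma>)) (sequentially \<times>\<^sub>F sequentially)"
      by (rule uniform_limit_compose') auto
    moreover have "G (of_int k) = g (U (\<gamma> * of_int k) f)" for k
      using F_real[of "\<gamma> * of_int k"] by (simp add: G_def)
    moreover have "G (z / of_real \<gamma>) = F z" for z
      using \<gamma> by (simp add: G_def)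
    ultimately show ?thesis
      by (simp add: cardinal_partial_sum_def case_prod_beta')
  qed
  have "((\<lambda>(m, n). \<Sum>k = - int m..int n.
        g (U (\<gamma> * of_int k) f) * csinc (z / complex_of_real \<gamma> - of_int k)) \<longlongrightarrow> F z)
      (sequentially \<times>\<^sub>F sequentially)"
    if "0 < \<gamma>" "\<gamma> * \<sigma> < pi" for \<gamma> z
    using tendsto_uniform_limitI[OF sampling[OF that, of "{z}"], of z]
    by (simp add: case_prod_beta')
  then show ?thesis
    using space F_type F_real sampling unfolding F_def by blast
qed

end
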